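(* Let $n\ge 1$ and $N\ge 1$. (i) Let $V_X(\lambda)=V(\lambda)=\sum_{q=0}^{p}C_q\lambda^{q+1}$ be an $X$-independent polynomial, where $p\ge 0$ is an integer, $C_q\in\mathbb{R}$, and $C_p>0$. Then $$\inf_{\pm,\ X\in\mathbb{Z}^n,\ \lambda\ge 0,\ \mu\ge 0}\Big[B_X(\lambda,\mu)+2\,\partial_\lambda B_X(\lambda,\mu)\,(\lambda\pm\sqrt{\lambda\mu})\Big]>-\infty .$$ (ii) Assume that $$V_X(\lambda)=\sum_{q=0}^{4}C_{X,q}\lambda^{q+1},\qquad X\in\mathbb{Z}^n,\ \lambda\ge 0,$$ where $C_{X,q}\ge 0$ for $X\in\mathbb{Z}^n$ and $1\le q\le 4$, and the real numbers $C_{X,0}$ are uniformly bounded from below: $$k_3:=\inf_{X\in\mathbb{Z}^n}C_{X,0}>-\infty .$$ Define $\tau_3=\sqrt{-1/k_3}$ if $k_3<0$ and $\tau_3=+\infty$ if $k_3\ge 0$. Then for any $\tau\in(0,\tau_3)$, any $\varepsilon>0$, and arbitrary initial data $\psi^0,\psi^1:\mathbb{Z}^n\to\mathbb{C}^N$, there exists a solution $\psi:\mathbb{Z}^n\times\mathbb{Z}\to\mathbb{C}^N$ to the Cauchy problem for the discrete nonlinear wave equation $$\frac{\psi_X^{T+1}-2\psi_X^T+\psi_X^{T-1}}{\tau^2}=\sum_{j=1}^n\frac{\psi_{X+e_j}^T-2\psi_X^T+\psi_{X-e_j}^T}{\varepsilon^2}-B_X(|\psi_X^{T+1}|^2,|\psi_X^{T-1}|^2)\,(\psi_X^{T+1}+\psi_X^{T-1}),\qquad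 (X,T)\in\mathbb{Z}^n\times\mathbb{Z},$$ with the values of $\psi^T$ at $T=0$ and $T=1$ equal to the given $\psi^0$ and $\psi^1$, and this solution is unique.
   Context: The unknown is a function $\psi:\mathbb{Z}^n\times\mathbb{Z}\to\mathbb{C}^N$, $(X,T)\mapsto\psi_X^T$; $\psi^T$ denotes the function $X\mapsto\psi_X^T$ on $\mathbb{Z}^n$. Here $e_1,\dots,e_n$ is the standard basis of $\mathbb{Z}^n$ and $|\psi|^2=\bar\psi\cdot\psi$ for $\psi\in\mathbb{C}^N$. Each $V_X$ is a real-valued $C^2$ function on $\mathbb{R}$. For $X\in\mathbb{Z}^n$ and $\lambda,\mu\in\mathbb{R}$, $$B_X(\lambda,\mu)=\frac{V_X(\lambda)-V_X(\mu)}{\lambda-\mu}\ \text{ if }\lambda\ne\mu,\qquad B_X(\lambda,\lambda)=\partial_\lambda V_X(\lambda),$$ and $\partial_\lambda B_X(\lambda,\mu)$ is the partial derivative of $B_X$ with respect to its first argument. *)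

theory Defs
  imports "HOL-Analysis.Analysis"
begin

text \<open>
  The lattice \<open>\<int>\<^sup>n\<close> is \<^typ>\<open>int ^ 'n\<close>, with standard basis vectors \<open>axis j 1\<close>, and the
  values of the unknown lie in \<^typ>\<open>complex ^ 'N\<close>, whose norm is the Hermitian one,
  so that \<open>(norm u)\<^sup>2\<close> is \<open>\<bar>u\<bar>\<^sup>2\<close>.
\<close>

definition C2_real :: "(real \<Rightarrow> real) \<Rightarrow> bool" where
  "C2_real f \<longleftrightarrow>
     (\<forall>x. f differentiable (at x)) \<and>
     (\<forall>x. deriv f differentiable (at x)) \<and>
     continuous_on UNIV (deriv (deriv f))"

definition B :: "(int ^ 'n \<Rightarrow> real \<Rightarrow> real) \<Rightarrow> int ^ 'n \<Rightarrow> real \<Rightarrow> real \<Rightarrow> real" where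
  "B V X l m = (if l \<noteq> m then (V X l - V X m) / (l - m) else deriv (V X) l)"

definition dB :: "(int ^ 'n \<Rightarrow> real \<Rightarrow> real) \<Rightarrow> int ^ 'n \<Rightarrow> real \<Rightarrow> real \<Rightarrow> real" where
  "dB V X l m = deriv (\<lambda>x. B V X x m) l"

definition discrete_wave_solution ::
    "(int ^ 'n \<Rightarrow> real \<Rightarrow> real) \<Rightarrow> real \<Rightarrow> real \<Rightarrow>
     (int ^ 'n \<Rightarrow> int \<Rightarrow> complex ^ 'N) \<Rightarrow> bool" where
  "discrete_wave_solution V \<tau> \<epsilon> \<psi> \<longleftrightarrow>
     (\<forall>X T.
        (\<psi> X (T + 1) - 2 *\<^sub>R \<psi> X T + \<psi> X (T - 1)) /\<^sub>R \<tau>\<^sup>2 =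
        (\<Sum>j\<in>UNIV. (\<psi> (X + axis j 1) T - 2 *\<^sub>R \<psi> X T + \<psi> (X - axis j 1) T) /\<^sub>R \<epsilon>\<^sup>2)
        - B V X ((norm (\<psi> X (T + 1)))\<^sup>2) ((norm (\<psi> X (T - 1)))\<^sup>2)
            *\<^sub>R (\<psi> X (T + 1) + \<psi> X (T - 1)))"

definition tau3 :: "real \<Rightarrow> ereal" where
  "tau3 k = (if k < 0 then ereal (sqrt (- 1 / k)) else \<infinity>)"

end

theory Submission
  imports Defs
begin

text \<open>
  For \<open>V(\<lambda>) = \<lambda> ^ (q + 1)\<close> one has \<open>B(\<lambda>, \<mu>) = h(\<lambda>, \<mu>) = \<Sum>i\<le>q. \<lambda> ^ i * \<mu> ^ (q - i)\<close>. With
  \<open>\<lambda> = a\<^sup>2\<close> and \<open>\<mu> = b\<^sup>2\<close>, \<open>b\<close> of either sign, the bracket \<open>B + 2 \<partial>B (\<lambda> \<plusminus> \<surd>(\<lambda>\<mu>))\<close> is an explicit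
  sum of squares that vanishes only at the origin when \<open>q > 0\<close>. It is homogeneous of degree
  \<open>q\<close> in \<open>(\<lambda>, \<mu>)\<close>, so the bracket of the top monomial dominates the others away from the origin, which
  gives the infimum bound.

  For the Cauchy problem, fix \<open>T\<close> and \<open>X\<close> and put \<open>u = \<psi>(T + 1)\<close>, \<open>v = \<psi>(T - 1)\<close>. The equation reads
  \<open>(1 / \<tau>\<^sup>2 + B(\<bar>u\<bar>\<^sup>2, \<bar>v\<bar>\<^sup>2)) (u + v) = \<xi>\<close> with \<open>\<xi>\<close> depending on time \<open>T\<close> only, and the factor is
  positive because \<open>\<tau> < \<tau>\<^sub>3\<close>. So \<open>u + v = s \<xi>\<close> for a scalar \<open>s\<close>, and \<open>s\<close> solves a scalar equation whose
  left-hand side is strictly increasing, again by nonnegativity of the bracket. As \<open>B\<close> is symmetric,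
  the equation can be solved for \<open>v\<close> as well, so the recursion runs in both time directions.
\<close>

section \<open>Divided differences of monomials and of polynomials\<close>

definition hsum :: "nat \<Rightarrow> 'a::comm_semiring_1 \<Rightarrow> 'a \<Rightarrow> 'a" where
  "hsum q l m = (\<Sum>i\<le>q. l ^ i * m ^ (q - i))"

text \<open>The derivative of \<open>hsum q l m\<close> in \<open>l\<close>. For
  \<open>i = 0\<close> the exponent \<open>i - 1\<close> truncates to 0, but the factor
  \<open>of_nat i\<close> removes that summand.\<close>

definition dhsum :: "nat \<Rightarrow> 'a::comm_semiring_1 \<Rightarrow> 'a \<Rightarrow> 'a" where
  "dhsum q l m = (\<Sum>i\<le>q. of_nat i * l ^ (i - 1) * m ^ (q - i))"

lemma hsum_Suc: "hsum (Suc q) l m = m * hsum q l m + l ^ Suc q"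
  by (auto simp: hsum_def sum_distrib_left Suc_diff_le algebra_simps intro!: sum.cong)

lemma dhsum_Suc: "dhsum (Suc q) l m = m * dhsum q l m + of_nat (Suc q) * l ^ q"
  unfolding dhsum_def
  by (auto simp: sum_distrib_left Suc_diff_le algebra_simps simp del: of_nat_Suc intro!: sum.cong)

lemma hsum_0 [simp]: "hsum 0 l m = 1"
  by (simp add: hsum_def)

lemma dhsum_0 [simp]: "dhsum 0 l m = 0"
  by (simp add: dhsum_def)

lemma power_Suc_diff_hsum:
  fixes l m :: "'a::comm_ring_1"
  shows "l ^ Suc q - m ^ Suc q = (l - m) * hsum q l m"
  by (simp add: diff_power_eq_sum hsum_def lessThan_Suc_atMost del: power_Suc)

lemma hsum_diag: "hsum q l l = of_nat (Suc q) * l ^ q"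
  by (induction q) (simp_all add: hsum_Suc algebra_simps)

lemma hsum_nonneg: "0 \<le> l \<Longrightarrow> 0 \<le> m \<Longrightarrow> 0 \<le> hsum q l m" for l m :: real
  by (simp add: hsum_def sum_nonneg)

lemma dhsum_nonneg: "0 \<le> l \<Longrightarrow> 0 \<le> m \<Longrightarrow> 0 \<le> dhsum q l m" for l m :: real
  by (simp add: dhsum_def sum_nonneg)

lemma has_real_derivative_hsum:
  "((\<lambda>l. hsum q l m) has_real_derivative dhsum q l m) (at l)"
  unfolding hsum_def dhsum_def
  by (auto intro!: derivative_eq_intros simp: algebra_simps)

text \<open>On the diagonal, \<open>deriv (V X) l\<close> is also the derivative within
  \<open>S\<close>, hence fixed by the values on \<open>S\<close> alone. With
  \<open>S = {0..}\<close> this covers the endpoint \<open>l = 0\<close>, where a one-sided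
  derivative must determine the full one.\<close>

lemma B_polynomial:
  fixes V :: "int ^ 'n \<Rightarrow> real \<Rightarrow> real"
  assumes V: "\<And>x. x \<in> S \<Longrightarrow> V X x = (\<Sum>q = 0..p. C q * x ^ (q + 1))"
    and diff: "V X differentiable (at l)"
    and S: "l \<in> S" "m \<in> S" "at l within S \<noteq> bot"
  shows "B V X l m = (\<Sum>q = 0..p. C q * hsum q l m)"
proof (cases "l = m")
  case False
  have "V X l - V X m = (\<Sum>q = 0..p. C q * (l ^ Suc q - m ^ Suc q))"
    using S V by (simp add: sum_subtractf algebra_simps)
  also have "\<dots> = (l - m) * (\<Sum>q = 0..p. C q * hsum q l m)"
    by (simp only: power_Suc_diff_hsum sum_distrib_left ac_simps)
  finally show ?thesis
    using False by (simp add: B_def)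
next
  case True
  have "((\<lambda>x. \<Sum>q = 0..p. C q * x ^ (q + 1)) has_real_derivative
      (\<Sum>q = 0..p. C q * hsum q l l)) (at l within S)"
    by (auto intro!: derivative_eq_intros sum.cong simp: hsum_diag simp del: power_Suc)
  then have 1: "(V X has_real_derivative (\<Sum>q = 0..p. C q * hsum q l l)) (at l within S)"
    by (rule has_field_derivative_transform_within[where d = 1]) (use S V in auto)
  have "(V X has_real_derivative deriv (V X) l) (at l within S)"
    using diff DERIV_deriv_iff_real_differentiable has_field_derivative_at_within by blast
  then have "deriv (V X) l = (\<Sum>q = 0..p. C q * hsum q l l)"
    using 1 S(3) by (meson has_field_derivative_unique)
  then show ?thesis
    using True by (simp add: B_def)
qed

lemma B_commute: "B V X l m = B V X m l"
  by (auto simp: B_def divide_simps) (simp add: algebra_simps)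

section \<open>Positivity and size of the bracket\<close>

text \<open>
  Both sides equal \<open>\<Sum>k = 1..2 * q + 1. k * a ^ (k - 1) * b ^ (2 * q + 1 - k)\<close>, the derivative in \<open>a\<close> of
  \<open>(a + b) * hsum q (a\<^sup>2) (b\<^sup>2) = (a ^ (2 * q + 2) - b ^ (2 * q + 2)) / (a - b)\<close>.
\<close>

lemma hsum_dhsum_sum_of_squares:
  fixes a b :: "'a::comm_ring_1"
  shows "hsum q (a\<^sup>2) (b\<^sup>2) + 2 * dhsum q (a\<^sup>2) (b\<^sup>2) * (a\<^sup>2 + a * b) =
    (\<Sum>i<q. of_nat (i + 1) * (a\<^sup>2) ^ i * (b\<^sup>2) ^ (q - 1 - i) * (a + b)\<^sup>2)
    + of_nat (q + 1) * (a\<^sup>2) ^ q" (is "?L q = ?S q + ?R q")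
proof (induction q)
  case (Suc q)
  have "?S (Suc q) = b\<^sup>2 * ?S q + of_nat (q + 1) * (a\<^sup>2) ^ q * (a + b)\<^sup>2"
    unfolding sum.lessThan_Suc sum_distrib_left
  proof (intro arg_cong2[where f = "(+)"] sum.cong refl)
    fix i assume "i \<in> {..<q}"
    then have "Suc q - 1 - i = Suc (q - 1 - i)"
      by simp
    then show "of_nat (i + 1) * (a\<^sup>2) ^ i * (b\<^sup>2) ^ (Suc q - 1 - i) * (a + b)\<^sup>2 =
        b\<^sup>2 * (of_nat (i + 1) * (a\<^sup>2) ^ i * (b\<^sup>2) ^ (q - 1 - i) * (a + b)\<^sup>2)"
      by (simp only: power_Suc ac_simps)
  qed simp
  moreover have "?L (Suc q) =
      b\<^sup>2 * ?L q + (a\<^sup>2) ^ q * a\<^sup>2 + 2 * of_nat (q + 1) * (a\<^sup>2) ^ q * (a\<^sup>2 + a * b)"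
    by (simp add: hsum_Suc dhsum_Suc algebra_simps)
  moreover have "?R (Suc q) = of_nat (q + 1) * (a\<^sup>2) ^ q * a\<^sup>2 + (a\<^sup>2) ^ q * a\<^sup>2"
    by (simp add: algebra_simps power2_eq_square)
  ultimately show ?case
    unfolding Suc by (simp add: algebra_simps power2_eq_square)
qed simp

lemma hsum_dhsum_nonneg:
  fixes a b :: real
  shows "0 \<le> hsum q (a\<^sup>2) (b\<^sup>2) + 2 * dhsum q (a\<^sup>2) (b\<^sup>2) * (a\<^sup>2 + a * b)"
  unfolding hsum_dhsum_sum_of_squares
  by (intro add_nonneg_nonneg sum_nonneg mult_nonneg_nonneg) auto

text \<open>In the sum of squares, the term \<open>(q + 1) * (a\<^sup>2) ^ q\<close> suffices if
  \<open>b\<^sup>2 \<le> 4 * a\<^sup>2\<close>. Otherwise \<open>a\<close> is too small to cancel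
  \<open>b\<close> in \<open>a + b\<close>, and the summand \<open>i = 0\<close> suffices.\<close>

lemma hsum_dhsum_ge:
  fixes a b :: real
  shows "(max (a\<^sup>2) (b\<^sup>2)) ^ q / 4 ^ Suc q
    \<le> hsum q (a\<^sup>2) (b\<^sup>2) + 2 * dhsum q (a\<^sup>2) (b\<^sup>2) * (a\<^sup>2 + a * b)"
proof -
  let ?M = "max (a\<^sup>2) (b\<^sup>2)"
  let ?f = "\<lambda>i. of_nat (i + 1) * (a\<^sup>2) ^ i * (b\<^sup>2) ^ (q - 1 - i) * (a + b)\<^sup>2"
  have f: "0 \<le> ?f i" for i
    by (intro mult_nonneg_nonneg) auto
  have M: "0 \<le> ?M ^ q"
    by (simp add: le_max_iff_disj)
  have *: "?M ^ q / 4 ^ Suc q \<le> (\<Sum>i<q. ?f i) + of_nat (q + 1) * (a\<^sup>2) ^ q"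
  proof (cases "b\<^sup>2 \<le> 4 * a\<^sup>2")
    case True
    then have "?M ^ q \<le> (4 * a\<^sup>2) ^ q"
      by (intro power_mono) (auto simp: le_max_iff_disj)
    then have "?M ^ q / 4 ^ q \<le> (a\<^sup>2) ^ q"
      by (simp add: power_mult_distrib field_simps)
    moreover have "?M ^ q / 4 ^ Suc q \<le> ?M ^ q / 4 ^ q"
      using M by (intro divide_left_mono) auto
    moreover have "(a\<^sup>2) ^ q \<le> of_nat (q + 1) * (a\<^sup>2) ^ q"
      by (simp add: mult_le_cancel_right1)
    moreover have "0 \<le> (\<Sum>i<q. ?f i)"
      by (intro sum_nonneg f)
    ultimately show ?thesis
      by linarith
  next
    case False
    then have Mb: "?M = b\<^sup>2"
      by (smt (verit) zero_le_power2)
    show ?thesis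
    \<comment> \<open>The summand \<open>i = 0\<close> exists only for \<open>q > 0\<close>; for
      \<open>q = 0\<close> the last term is the constant 1.\<close>
    proof (cases q)
      case (Suc k)
      have "\<bar>2 * a\<bar> \<le> \<bar>b\<bar>"
        using False by (simp add: abs_le_square_iff power_mult_distrib)
      then have "\<bar>b\<bar> / 2 \<le> \<bar>a + b\<bar>"
        by linarith
      then have "(\<bar>b\<bar> / 2)\<^sup>2 \<le> \<bar>a + b\<bar>\<^sup>2"
        by (intro power_mono) auto
      then have "b\<^sup>2 / 4 \<le> (a + b)\<^sup>2"
        by (simp add: power_divide)
      then have "(b\<^sup>2) ^ k * (b\<^sup>2 / 4) \<le> (b\<^sup>2) ^ k * (a + b)\<^sup>2"
        by (intro mult_left_mono) auto
      also have "\<dots> = ?f 0"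
        using Suc by simp
      also have "\<dots> \<le> (\<Sum>i<q. ?f i)"
        using Suc f by (intro member_le_sum) auto
      also have "(b\<^sup>2) ^ k * (b\<^sup>2 / 4) = ?M ^ q / 4"
        using Suc Mb by (simp only: power_Suc) simp
      finally have "?M ^ q / 4 \<le> (\<Sum>i<q. ?f i)" .
      moreover have "?M ^ q / 4 ^ Suc q \<le> ?M ^ q / 4"
        using M by (intro divide_left_mono) auto
      moreover have "0 \<le> of_nat (q + 1) * (a\<^sup>2) ^ q"
        by simp
      ultimately show ?thesis
        by linarith
    qed simp
  qed
  then show ?thesis
    by (simp only: hsum_dhsum_sum_of_squares)
qed

lemma hsum_dhsum_le:
  fixes a b :: real
  shows "hsum q (a\<^sup>2) (b\<^sup>2) + 2 * dhsum q (a\<^sup>2) (b\<^sup>2) * (a\<^sup>2 + a * b)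
    \<le> (\<Sum>i<q. 4 * (real i + 1)) * (max (a\<^sup>2) (b\<^sup>2)) ^ q + (real q + 1) * (max (a\<^sup>2) (b\<^sup>2)) ^ q"
proof -
  let ?M = "max (a\<^sup>2) (b\<^sup>2)"
  have M: "0 \<le> ?M"
    by (simp add: le_max_iff_disj)
  \<comment> \<open>Parallelogram law: \<open>(a + b)\<^sup>2\<close> is at most
    \<open>2 * (a\<^sup>2 + b\<^sup>2)\<close>, hence at most \<open>4 * ?M\<close>.\<close>
  have "(a + b)\<^sup>2 + (a - b)\<^sup>2 = 2 * (a\<^sup>2 + b\<^sup>2)"
    by (simp add: power2_eq_square algebra_simps)
  then have ab: "(a + b)\<^sup>2 \<le> 4 * ?M"
    by (smt (verit) zero_le_power2)
  have "of_nat (i + 1) * (a\<^sup>2) ^ i * (b\<^sup>2) ^ (q - 1 - i) * (a + b)\<^sup>2 \<le> 4 * (real i + 1) * ?M ^ q"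
    if "i < q" for i
  proof -
    have "(a\<^sup>2) ^ i * (b\<^sup>2) ^ (q - 1 - i) * (a + b)\<^sup>2 \<le> ?M ^ i * ?M ^ (q - 1 - i) * (4 * ?M)"
      using ab M by (intro mult_mono power_mono) auto
    also have "\<dots> = 4 * ?M ^ (i + (q - 1 - i) + 1)"
      by (simp add: power_add)
    also have "i + (q - 1 - i) + 1 = q"
      using that by simp
    finally have "(real i + 1) * ((a\<^sup>2) ^ i * (b\<^sup>2) ^ (q - 1 - i) * (a + b)\<^sup>2) \<le> (real i + 1) * (4 * ?M ^ q)"
      by (intro mult_left_mono) auto
    then show ?thesis
      by (simp add: algebra_simps)
  qed
  then have "(\<Sum>i<q. of_nat (i + 1) * (a\<^sup>2) ^ i * (b\<^sup>2) ^ (q - 1 - i) * (a + b)\<^sup>2)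
      \<le> (\<Sum>i<q. 4 * (real i + 1)) * ?M ^ q"
    unfolding sum_distrib_right by (intro sum_mono) auto
  moreover have "of_nat (q + 1) * (a\<^sup>2) ^ q \<le> (real q + 1) * ?M ^ q"
    by (intro mult_mono power_mono) auto
  ultimately show ?thesis
    unfolding hsum_dhsum_sum_of_squares by linarith
qed

section \<open>Lower bound for polynomials with positive leading coefficient\<close>

lemma sum_hsum_dhsum_bounded_below:
  fixes C :: "nat \<Rightarrow> real"
  assumes "C p > 0"
  obtains K where "\<And>a b. K \<le> (\<Sum>q = 0..p. C q * (hsum q (a\<^sup>2) (b\<^sup>2)
      + 2 * dhsum q (a\<^sup>2) (b\<^sup>2) * (a\<^sup>2 + a * b)))"
proof -
  let ?F = "\<lambda>q a b. hsum q (a\<^sup>2) (b\<^sup>2) + 2 * dhsum q (a\<^sup>2) (b\<^sup>2) * (a\<^sup>2 + a * b :: real)"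
  \<comment> \<open>\<open>k q\<close> is the constant of \<open>hsum_dhsum_le\<close>, and
    \<open>c\<close> comes from \<open>hsum_dhsum_ge\<close> for the top term. Beyond
    \<open>R\<close> the top term outweighs all lower ones; up to \<open>R\<close> these total at
    most \<open>A * R ^ p\<close>.\<close>
  define k where "k q = (\<Sum>i<q. 4 * (real i + 1)) + (real q + 1)" for q
  define A where "A = (\<Sum>q<p. \<bar>C q\<bar> * k q)"
  define c where "c = C p / 4 ^ Suc p"
  define R where "R = max 1 (A / c)"
  have c: "c > 0"
    using assms by (simp add: c_def)
  have k: "0 \<le> k q" for q
    unfolding k_def by (intro add_nonneg_nonneg sum_nonneg) auto
  have A: "0 \<le> A"
    unfolding A_def by (intro sum_nonneg mult_nonneg_nonneg k) auto
  have "- (A * R ^ p) \<le> (\<Sum>q = 0..p. C q * ?F q a b)" for a b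
  proof -
    define M where "M = max (a\<^sup>2) (b\<^sup>2)"
    have M: "0 \<le> M"
      by (simp add: M_def le_max_iff_disj)
    have low: "- (\<bar>C q\<bar> * k q * M ^ q) \<le> C q * ?F q a b" for q
    proof -
      have "\<bar>C q\<bar> * ?F q a b \<le> \<bar>C q\<bar> * (k q * M ^ q)"
        using hsum_dhsum_le[of q a b] unfolding k_def M_def
        by (intro mult_left_mono) (auto simp: algebra_simps)
      moreover have "- (\<bar>C q\<bar> * ?F q a b) \<le> C q * ?F q a b"
        using mult_right_mono[OF _ hsum_dhsum_nonneg, of "- \<bar>C q\<bar>" "C q" q a b] by simp
      ultimately show ?thesis
        by (simp add: mult.assoc)
    qed
    have top: "c * M ^ p \<le> C p * ?F p a b"
      using mult_left_mono[OF hsum_dhsum_ge, of "C p" a b p] assms unfolding c_def M_def by simp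
    have "- (A * R ^ p) \<le> - (\<Sum>q<p. \<bar>C q\<bar> * k q * M ^ q) + c * M ^ p"
    proof (cases "M \<le> R")
      case True
      have "M ^ q \<le> R ^ p" if "q < p" for q
      proof -
        have "M ^ q \<le> R ^ q"
          using True M by (intro power_mono) auto
        also have "\<dots> \<le> R ^ p"
          using that by (intro power_increasing) (auto simp: R_def)
        finally show ?thesis .
      qed
      then have "(\<Sum>q<p. \<bar>C q\<bar> * k q * M ^ q) \<le> (\<Sum>q<p. \<bar>C q\<bar> * k q * R ^ p)"
        by (intro sum_mono mult_left_mono mult_nonneg_nonneg k) auto
      moreover have "(\<Sum>q<p. \<bar>C q\<bar> * k q * R ^ p) = A * R ^ p"
        by (simp add: A_def sum_distrib_right)
      moreover have "0 \<le> c * M ^ p"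
        using c M by simp
      ultimately show ?thesis
        by linarith
    next
      case False
      then have M1: "1 \<le> M" and "A / c \<le> M"
        by (auto simp: R_def)
      then have AM: "A \<le> c * M"
        using c by (simp add: field_simps)
      \<comment> \<open>As \<open>1 \<le> M\<close>, every lower power is at most
        \<open>M ^ (p - 1)\<close>. For \<open>p = 0\<close> the exponent truncates, but then the
        sum is empty and \<open>A = 0\<close>.\<close>
      have "(\<Sum>q<p. \<bar>C q\<bar> * k q * M ^ q) \<le> (\<Sum>q<p. \<bar>C q\<bar> * k q * M ^ (p - 1))"
        using M1 by (intro sum_mono mult_left_mono mult_nonneg_nonneg k power_increasing) auto
      also have "\<dots> = A * M ^ (p - 1)"
        by (simp add: A_def sum_distrib_right)
      also have "\<dots> \<le> c * M ^ p"
      proof (cases p)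
        case 0
        then show ?thesis
          using c by (simp add: A_def)
      next
        case (Suc r)
        then show ?thesis
          using mult_right_mono[OF AM, of "M ^ r"] M by simp
      qed
      finally show ?thesis
        using A by (smt (verit) R_def mult_nonneg_nonneg zero_le_power)
    qed
    also have "- (\<Sum>q<p. \<bar>C q\<bar> * k q * M ^ q) \<le> (\<Sum>q<p. C q * ?F q a b)"
      unfolding sum_negf[symmetric] by (intro sum_mono low)
    also have "(\<Sum>q<p. C q * ?F q a b) + c * M ^ p \<le> (\<Sum>q<p. C q * ?F q a b) + C p * ?F p a b"
      using top by simp
    also have "\<dots> = (\<Sum>q = 0..p. C q * ?F q a b)"
      by (simp add: atLeast0AtMost lessThan_Suc_atMost[symmetric])
    finally show ?thesis
      by simp
  qed
  then show ?thesis
    by (rule that)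
qed

lemma B_dB_bounded_below:
  fixes V :: "int ^ 'n \<Rightarrow> real \<Rightarrow> real"
  assumes "C p > 0" and V: "\<And>X x. V X x = (\<Sum>q = 0..p. C q * x ^ (q + 1))"
  shows "(INF (s, X, l, m) \<in> {1, - 1} \<times> UNIV \<times> {0..} \<times> {0..}.
    ereal (B V X l m + 2 * dB V X l m * (l + s * sqrt (l * m)))) > - \<infinity>"
proof -
  obtain K where K: "\<And>a b. K \<le> (\<Sum>q = 0..p. C q * (hsum q (a\<^sup>2) (b\<^sup>2)
      + 2 * dhsum q (a\<^sup>2) (b\<^sup>2) * (a\<^sup>2 + a * b)))"
    using sum_hsum_dhsum_bounded_below[of C p] assms(1) by blast
  have VX: "V X = (\<lambda>x. \<Sum>q = 0..p. C q * x ^ (q + 1))" for X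
    using V by auto
  have B: "B V X l m = (\<Sum>q = 0..p. C q * hsum q l m)" for X l m
    by (rule B_polynomial[where S = UNIV]) (auto simp: VX)
  have dB: "dB V X l m = (\<Sum>q = 0..p. C q * dhsum q l m)" for X l m
    unfolding dB_def B
    by (rule DERIV_imp_deriv) (auto intro!: derivative_eq_intros has_real_derivative_hsum simp: mult.commute)
  have bound: "K \<le> B V X l m + 2 * dB V X l m * (l + s * sqrt (l * m))"
    if "s = 1 \<or> s = - 1" "0 \<le> l" "0 \<le> m" for s X l m
  proof -
    have "(s * sqrt m)\<^sup>2 = m" "(sqrt l)\<^sup>2 = l" "sqrt l * (s * sqrt m) = s * sqrt (l * m)"
      using that by (auto simp: power_mult_distrib real_sqrt_mult)
    then have "K \<le> (\<Sum>q = 0..p. C q * (hsum q l m + 2 * dhsum q l m * (l + s * sqrt (l * m))))"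
      using K[of "sqrt l" "s * sqrt m"] by (simp only:)
    also have "\<dots> = B V X l m + 2 * dB V X l m * (l + s * sqrt (l * m))"
      by (simp add: B dB sum_distrib_left sum_distrib_right sum.distrib distrib_left mult_ac)
    finally show ?thesis .
  qed
  have "ereal K \<le> (INF (s, X, l, m) \<in> {1, - 1} \<times> UNIV \<times> {0..} \<times> {0..}.
    ereal (B V X l m + 2 * dB V X l m * (l + s * sqrt (l * m))))"
    by (intro INF_greatest) (auto simp: bound[of 1, simplified] bound[of "- 1", simplified])
  then show ?thesis
    by (rule less_le_trans[rotated]) simp
qed

section \<open>The equation for a single time step at a single site\<close>

text \<open>With \<open>u = x *\<^sub>R \<xi> - v\<close>, the derivative in \<open>x\<close> is the
  bracket with \<open>(x *\<^sub>R \<xi>) \<bullet> u\<close> in place of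
  \<open>a\<^sup>2 + a * b\<close>. Since \<open>x *\<^sub>R \<xi> = u + v\<close>, Cauchy-Schwarz
  reduces its sign to \<open>hsum_dhsum_nonneg\<close> at \<open>a = norm u\<close>,
  \<open>b = - norm v\<close>, whatever the sign of \<open>x\<close>.\<close>

lemma mult_hsum_mono:
  fixes \<xi> v :: "'a::real_inner"
  assumes "s \<le> t"
  shows "s * hsum q ((norm (s *\<^sub>R \<xi> - v))\<^sup>2) ((norm v)\<^sup>2) \<le> t * hsum q ((norm (t *\<^sub>R \<xi> - v))\<^sup>2) ((norm v)\<^sup>2)"
proof (rule DERIV_nonneg_imp_nondecreasing[OF assms])
  fix x assume x: "s \<le> x" "x \<le> t"
  let ?u = "x *\<^sub>R \<xi> - v"
  let ?h = "hsum q ((norm ?u)\<^sup>2) ((norm v)\<^sup>2)" and ?d = "dhsum q ((norm ?u)\<^sup>2) ((norm v)\<^sup>2)"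
  have "((\<lambda>x. (norm (x *\<^sub>R \<xi> - v))\<^sup>2) has_real_derivative 2 * (\<xi> \<bullet> ?u)) (at x)"
    unfolding power2_norm_eq_inner has_field_derivative_def
    by (auto intro!: derivative_eq_intros simp: fun_eq_iff inner_commute algebra_simps)
  from DERIV_mult[OF DERIV_ident DERIV_chain2[OF has_real_derivative_hsum this]]
  have "((\<lambda>x. x * hsum q ((norm (x *\<^sub>R \<xi> - v))\<^sup>2) ((norm v)\<^sup>2)) has_real_derivative
      ?h + 2 * ?d * ((x *\<^sub>R \<xi>) \<bullet> ?u)) (at x)"
    by (simp add: algebra_simps)
  moreover have "0 \<le> ?h + 2 * ?d * ((x *\<^sub>R \<xi>) \<bullet> ?u)"
  proof -
    have "0 \<le> ?h + 2 * ?d * ((norm ?u)\<^sup>2 + norm ?u * (- norm v))"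
      using hsum_dhsum_nonneg[of q "norm ?u" "- norm v"] by simp
    moreover have "(norm ?u)\<^sup>2 + norm ?u * (- norm v) \<le> (x *\<^sub>R \<xi>) \<bullet> ?u"
      using norm_cauchy_schwarz[of "?u" "- v"]
      by (simp add: power2_norm_eq_inner inner_diff inner_commute)
    then have "2 * ?d * ((norm ?u)\<^sup>2 + norm ?u * (- norm v)) \<le> 2 * ?d * ((x *\<^sub>R \<xi>) \<bullet> ?u)"
      by (intro mult_left_mono mult_nonneg_nonneg dhsum_nonneg) auto
    ultimately show ?thesis
      by linarith
  qed
  ultimately show "\<exists>y. ((\<lambda>x. x * hsum q ((norm (x *\<^sub>R \<xi> - v))\<^sup>2) ((norm v)\<^sup>2)) has_real_derivative y) (at x) \<and> 0 \<le> y"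
    by blast
qed

text \<open>A solution satisfies \<open>u + v = s *\<^sub>R \<xi>\<close> with \<open>s\<close> the
  inverse of the positive scalar factor, which leaves one monotone equation for \<open>s\<close>.
  The term \<open>q = 0\<close> is grouped with \<open>\<kappa>\<close> because \<open>C 0\<close>
  may be negative.\<close>

lemma ex1_add_scaled_eq:
  fixes \<xi> v :: "'a::real_inner"
  assumes \<kappa>: "0 < \<kappa> + C 0" and C: "\<And>q. 1 \<le> q \<Longrightarrow> q \<le> p \<Longrightarrow> 0 \<le> C q"
  shows "\<exists>!u. (\<kappa> + (\<Sum>q = 0..p. C q * hsum q ((norm u)\<^sup>2) ((norm v)\<^sup>2))) *\<^sub>R (u + v) = \<xi>"
proof -
  define g where "g u = \<kappa> + (\<Sum>q = 0..p. C q * hsum q ((norm u)\<^sup>2) ((norm v)\<^sup>2))" for u :: 'a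
  have g_eq: "g u = (\<kappa> + C 0) + (\<Sum>q = 1..p. C q * hsum q ((norm u)\<^sup>2) ((norm v)\<^sup>2))" for u
    by (simp add: g_def sum.atLeast_Suc_atMost)
  have g_ge: "\<kappa> + C 0 \<le> g u" for u
    unfolding g_eq using C by (auto intro!: sum_nonneg mult_nonneg_nonneg hsum_nonneg)
  then have g_pos: "0 < g u" for u
    using \<kappa> by (rule less_le_trans[rotated])
  have mono: "s * g (s *\<^sub>R \<xi> - v) < t * g (t *\<^sub>R \<xi> - v)" if "s < t" for s t
  proof -
    have "(\<Sum>q = 1..p. C q * (s * hsum q ((norm (s *\<^sub>R \<xi> - v))\<^sup>2) ((norm v)\<^sup>2)))
        \<le> (\<Sum>q = 1..p. C q * (t * hsum q ((norm (t *\<^sub>R \<xi> - v))\<^sup>2) ((norm v)\<^sup>2)))"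
      using that C by (intro sum_mono mult_left_mono mult_hsum_mono) auto
    \<comment> \<open>Strictness comes from this part alone; the other terms are merely
      nondecreasing.\<close>
    moreover have "s * (\<kappa> + C 0) < t * (\<kappa> + C 0)"
      using that \<kappa> by simp
    ultimately show ?thesis
      unfolding g_eq by (simp add: distrib_left sum_distrib_left mult.left_commute)
  qed
  \<comment> \<open>The right endpoint comes from \<open>g_ge\<close>: there \<open>s * g\<close> is
    at least 1, while it vanishes at \<open>s = 0\<close>.\<close>
  have "continuous_on {0..1 / (\<kappa> + C 0)} (\<lambda>s. s * g (s *\<^sub>R \<xi> - v))"
    unfolding g_def hsum_def by (intro continuous_intros)
  moreover have "1 \<le> 1 / (\<kappa> + C 0) * g ((1 / (\<kappa> + C 0)) *\<^sub>R \<xi> - v)"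
    using \<kappa> g_ge[of "(1 / (\<kappa> + C 0)) *\<^sub>R \<xi> - v"] by (simp add: field_simps)
  ultimately obtain s where s: "s * g (s *\<^sub>R \<xi> - v) = 1"
    using IVT'[of "\<lambda>s. s * g (s *\<^sub>R \<xi> - v)" 0 1 "1 / (\<kappa> + C 0)"] \<kappa> by auto
  have "\<exists>!u. g u *\<^sub>R (u + v) = \<xi>"
  proof (rule ex1I[of _ "s *\<^sub>R \<xi> - v"])
    show "g (s *\<^sub>R \<xi> - v) *\<^sub>R (s *\<^sub>R \<xi> - v + v) = \<xi>"
      using s by (simp add: mult.commute)
  next
    fix u assume u: "g u *\<^sub>R (u + v) = \<xi>"
    define t where "t = 1 / g u"
    have "u + v = t *\<^sub>R \<xi>"
      using g_pos[of u] u by (auto simp: t_def)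
    then have ut: "u = t *\<^sub>R \<xi> - v"
      by (simp add: algebra_simps)
    have "t * g (t *\<^sub>R \<xi> - v) = 1"
      unfolding ut[symmetric] using g_pos[of u] by (simp add: t_def)
    then have "t = s"
      using mono[of s t] mono[of t s] s by fastforce
    then show "u = s *\<^sub>R \<xi> - v"
      using ut by simp
  qed
  then show ?thesis
    unfolding g_def .
qed

section \<open>Two-sided recursion and the Cauchy problem\<close>

lemma ex1_two_sided_recurrence:
  fixes R :: "'s \<Rightarrow> 's \<Rightarrow> 's \<Rightarrow> bool"
  assumes fwd: "\<And>a b. \<exists>!c. R a b c" and bwd: "\<And>b c. \<exists>!a. R a b c"
  shows "\<exists>!f :: int \<Rightarrow> 's. (\<forall>T. R (f (T - 1)) (f T) (f (T + 1))) \<and> f 0 = x0 \<and> f 1 = x1"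
proof -
  obtain nxt where nxt: "\<And>a b. R a b (nxt a b)"
    using fwd by metis
  obtain prv where prv: "\<And>b c. R (prv b c) b c"
    using bwd by metis
  \<comment> \<open>\<open>F n\<close> holds the values at times \<open>n\<close> and
    \<open>n + 1\<close>, \<open>G n\<close> those at times \<open>- n\<close> and
    \<open>1 - n\<close>; both start from the given pair.\<close>
  define F where "F n = ((\<lambda>(a, b). (b, nxt a b)) ^^ n) (x0, x1)" for n :: nat
  define G where "G n = ((\<lambda>(b, c). (prv b c, b)) ^^ n) (x0, x1)" for n :: nat
  have F0: "F 0 = (x0, x1)" and FS: "F (Suc n) = (snd (F n), nxt (fst (F n)) (snd (F n)))" for n
    by (auto simp: F_def split_beta)
  have G0: "G 0 = (x0, x1)" and GS: "G (Suc n) = (prv (fst (G n)) (snd (G n)), fst (G n))" for n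
    by (auto simp: G_def split_beta)
  define f where "f T = (if 0 \<le> T then fst (F (nat T)) else fst (G (nat (- T))))" for T :: int
  have fF: "f (int n) = fst (F n)" for n
    by (simp add: f_def)
  have fG: "f (- int n) = fst (G n)" for n
    by (simp add: f_def F0 G0)
  have R: "R (f (T - 1)) (f T) (f (T + 1))" for T
  proof (cases "T \<ge> 1")
    case True
    then obtain n where n: "T = int n + 1"
      by (metis add.commute zle_iff_zadd)
    have "f (T - 1) = fst (F n)" "f T = fst (F (Suc n))" "f (T + 1) = fst (F (Suc (Suc n)))"
      using fF[of n] fF[of "Suc n"] fF[of "Suc (Suc n)"] by (simp_all add: n ac_simps)
    then show ?thesis
      by (simp add: FS nxt)
  next
    case False
    then obtain n where n: "T = - int n"
      by (metis int_cases2 int_one_le_iff_zero_less less_eq_int_code(1) not_le of_nat_0 of_nat_0_less_iff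
          neq0_conv minus_zero)
    \<comment> \<open>For \<open>n = 0\<close> the time \<open>T + 1 = 1\<close> lies on the forward
      branch, so the two branches must be matched there.\<close>
    have "f (T + 1) = snd (G n)"
    proof (cases n)
      case 0
      then show ?thesis
        using fF[of 1] by (simp add: n F0 FS G0)
    next
      case (Suc k)
      then show ?thesis
        using fG[of k] by (simp add: n GS)
    qed
    moreover have "T - 1 = - int (Suc n)"
      by (simp add: n)
    then have "f T = fst (G n)" "f (T - 1) = fst (G (Suc n))"
      using fG[of n] fG[of "Suc n"] n by (simp_all only:)
    ultimately show ?thesis
      by (simp add: GS prv)
  qed
  show ?thesis
  proof (rule ex1I[of _ f])
    show "(\<forall>T. R (f (T - 1)) (f T) (f (T + 1))) \<and> f 0 = x0 \<and> f 1 = x1"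
      using R fF[of 0] fF[of 1] by (simp add: F0 FS)
  next
    fix g :: "int \<Rightarrow> 's"
    assume g: "(\<forall>T. R (g (T - 1)) (g T) (g (T + 1))) \<and> g 0 = x0 \<and> g 1 = x1"
    \<comment> \<open>Each step of the recursion needs two consecutive values, so the induction in
      both directions carries a pair.\<close>
    have "g T = f T \<and> g (T + 1) = f (T + 1)" for T
    proof (induction T rule: int_induct[where k = 0])
      case base
      then show ?case
        using g fF[of 0] fF[of 1] by (simp add: F0 FS)
    next
      case (step1 i)
      then show ?case
        using g R[of "i + 1"] fwd[of "f i" "f (i + 1)"]
        by (metis add_diff_cancel_right')
    next
      case (step2 i)
      then show ?case
        using g R[of i] bwd[of "f i" "f (i + 1)"] by (metis diff_add_cancel)
    qed
    then show "g = f"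
      by auto
  qed
qed

text \<open>The lattice Laplacian involves time \<open>T\<close> only, so given the two earlier (or
  two later) time slices the sites decouple. The recursion runs on whole lattice functions and is
  solved site by site.\<close>

lemma discrete_wave_cauchy_problem:
  fixes V :: "int ^ 'n \<Rightarrow> real \<Rightarrow> real" and \<psi>0 \<psi>1 :: "int ^ 'n \<Rightarrow> complex ^ 'N"
  assumes diff: "\<And>X l. V X differentiable (at l)"
    and V: "\<And>X l. 0 \<le> l \<Longrightarrow> V X l = (\<Sum>q = 0..p. C X q * l ^ (q + 1))"
    and C: "\<And>X q. 1 \<le> q \<Longrightarrow> q \<le> p \<Longrightarrow> 0 \<le> C X q"
    and \<tau>: "\<tau> \<noteq> 0" "\<And>X. 0 < 1 / \<tau>\<^sup>2 + C X 0"
  shows "\<exists>!\<psi>. discrete_wave_solution V \<tau> \<epsilon> \<psi> \<and> (\<forall>X. \<psi> X 0 = \<psi>0 X) \<and> (\<forall>X. \<psi> X 1 = \<psi>1 X)"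
proof -
  define L where "L b X = (\<Sum>j\<in>UNIV. (b (X + axis j 1) - 2 *\<^sub>R b X + b (X - axis j 1)) /\<^sub>R \<epsilon>\<^sup>2)"
    for b :: "int ^ 'n \<Rightarrow> complex ^ 'N" and X
  define E where "E X a \<beta> c \<longleftrightarrow> (1 / \<tau>\<^sup>2 + B V X ((norm c)\<^sup>2) ((norm a)\<^sup>2)) *\<^sub>R (c + a) = \<beta>"
    for X and a \<beta> c :: "complex ^ 'N"
  define W where "W b X = L b X + (2 / \<tau>\<^sup>2) *\<^sub>R b X" for b :: "int ^ 'n \<Rightarrow> complex ^ 'N" and X
  define R where "R a b c \<longleftrightarrow> (\<forall>X. E X (a X) (W b X) (c X))"
    for a b c :: "int ^ 'n \<Rightarrow> complex ^ 'N"
  define Q where "Q f \<longleftrightarrow> (\<forall>T :: int. R (f (T - 1)) (f T) (f (T + 1))) \<and> f 0 = \<psi>0 \<and> f 1 = \<psi>1" for f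
  have B: "B V X l m = (\<Sum>q = 0..p. C X q * hsum q l m)" if "0 \<le> l" "0 \<le> m" for X l m
  proof (rule B_polynomial[where S = "{0..}"])
    \<comment> \<open>A right neighbourhood stays inside the half-line, so the filter is nontrivial
      even at \<open>l = 0\<close>.\<close>
    have "at_right l \<le> at l within {0..}"
      using that by (intro at_le) auto
    then show "at l within {0..} \<noteq> bot"
      by (metis bot.extremum_uniqueI trivial_limit_at_right_real)
  qed (use that V diff in auto)
  have E_ex1: "\<exists>!c. E X a \<beta> c" for X a \<beta>
    unfolding E_def using ex1_add_scaled_eq[of "1 / \<tau>\<^sup>2" "C X" p a \<beta>] \<tau> C by (simp add: B)
  have E_commute: "E X a \<beta> c = E X c \<beta> a" for X a \<beta> c
    by (simp add: E_def add.commute B_commute[of V X "(norm a)\<^sup>2"])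
  \<comment> \<open>By \<open>E_commute\<close> the same solution map \<open>S\<close> serves the
    forward and the backward step.\<close>
  obtain S where S: "\<And>X a \<beta> c. E X a \<beta> c \<longleftrightarrow> c = S X a \<beta>"
    using E_ex1 by metis
  have "R a b c \<longleftrightarrow> c = (\<lambda>X. S X (a X) (W b X))" for a b c
    by (auto simp: R_def S)
  then have "\<exists>!c. R a b c" for a b
    by simp
  moreover have "R a b c \<longleftrightarrow> a = (\<lambda>X. S X (c X) (W b X))" for a b c
    unfolding R_def E_commute[of _ "a _"] by (auto simp: S)
  then have "\<exists>!a. R a b c" for b c
    by simp
  ultimately have Q_ex1: "\<exists>!f. Q f"
    unfolding Q_def by (rule ex1_two_sided_recurrence)
  have eq: "(c - 2 *\<^sub>R b + a) /\<^sub>R \<tau>\<^sup>2 = l - k *\<^sub>R (c + a) \<longleftrightarrow>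
      (1 / \<tau>\<^sup>2 + k) *\<^sub>R (c + a) = l + (2 / \<tau>\<^sup>2) *\<^sub>R b" for a b c l :: "complex ^ 'N" and k
    by (auto simp: algebra_simps divide_inverse)
  have sol: "discrete_wave_solution V \<tau> \<epsilon> \<psi> \<longleftrightarrow>
      (\<forall>T. R (\<lambda>X. \<psi> X (T - 1)) (\<lambda>X. \<psi> X T) (\<lambda>X. \<psi> X (T + 1)))" for \<psi>
    unfolding discrete_wave_solution_def R_def E_def W_def L_def eq by blast
  let ?P = "\<lambda>\<psi>. discrete_wave_solution V \<tau> \<epsilon> \<psi> \<and> (\<forall>X. \<psi> X 0 = \<psi>0 X) \<and> (\<forall>X. \<psi> X 1 = \<psi>1 X)"
  have P: "?P \<psi> \<longleftrightarrow> Q (\<lambda>T X. \<psi> X T)" for \<psi>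
    unfolding Q_def sol fun_eq_iff by (rule refl)
  obtain f where f: "Q f" and f_unique: "\<And>g. Q g \<Longrightarrow> g = f"
    using Q_ex1 by blast
  show ?thesis
  proof (rule ex1I[of _ "\<lambda>X T. f T X"])
    show "?P (\<lambda>X T. f T X)"
      using P[of "\<lambda>X T. f T X"] f by simp
  next
    fix \<psi> assume "?P \<psi>"
    then have "(\<lambda>T X. \<psi> X T) = f"
      unfolding P by (rule f_unique)
    then show "\<psi> = (\<lambda>X T. f T X)"
      by auto
  qed
qed

text \<open>For \<open>k < 0\<close> the condition is \<open>\<tau>\<^sup>2 < - 1 / k\<close>, which
  is what the square root in \<open>tau3\<close> encodes.\<close>

lemma inverse_square_add_pos_if_less_tau3:
  assumes "0 < \<tau>" "ereal \<tau> < tau3 k"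
  shows "0 < 1 / \<tau>\<^sup>2 + k"
proof (cases "k < 0")
  case True
  then have "\<tau> < sqrt (- 1 / k)"
    using assms by (simp add: tau3_def)
  then have "\<tau>\<^sup>2 < - 1 / k"
    using assms(1) True by (metis less_eq_real_def real_less_lsqrt real_sqrt_less_iff real_sqrt_unique)
  then show ?thesis
    using True assms(1) by (simp add: field_simps)
next
  case False
  then show ?thesis
    using assms(1) by (simp add: add_pos_nonneg)
qed

theorem theorem2p8:
  shows
    "(\<forall>(V :: int ^ 'n \<Rightarrow> real \<Rightarrow> real) (p :: nat) (C :: nat \<Rightarrow> real).
        C p > 0 \<longrightarrow>
        (\<forall>X x. V X x = (\<Sum>q = 0..p. C q * x ^ (q + 1))) \<longrightarrow>
        (INF (s, X, l, m) \<in> {1, - 1} \<times> UNIV \<times> {0..} \<times> {0..}.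
           ereal (B V X l m + 2 * dB V X l m * (l + s * sqrt (l * m)))) > - \<infinity>)
     \<and>
     (\<forall>(V :: int ^ 'n \<Rightarrow> real \<Rightarrow> real) (C :: int ^ 'n \<Rightarrow> nat \<Rightarrow> real) (k3 :: real).
        (\<forall>X. C2_real (V X)) \<longrightarrow>
        (\<forall>X. \<forall>l \<ge> 0. V X l = (\<Sum>q = 0..4. C X q * l ^ (q + 1))) \<longrightarrow>
        (\<forall>X. \<forall>q \<in> {1..4}. C X q \<ge> 0) \<longrightarrow>
        bdd_below (range (\<lambda>X. C X 0)) \<longrightarrow>
        k3 = (INF X. C X 0) \<longrightarrow>
        (\<forall>(\<tau> :: real) (\<epsilon> :: real) (\<psi>0 :: int ^ 'n \<Rightarrow> complex ^ 'N) (\<psi>1 :: int ^ 'n \<Rightarrow> complex ^ 'N).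
           0 < \<tau> \<longrightarrow> ereal \<tau> < tau3 k3 \<longrightarrow> 0 < \<epsilon> \<longrightarrow>
           (\<exists>!\<psi> :: int ^ 'n \<Rightarrow> int \<Rightarrow> complex ^ 'N.
              discrete_wave_solution V \<tau> \<epsilon> \<psi> \<and>
              (\<forall>X. \<psi> X 0 = \<psi>0 X) \<and> (\<forall>X. \<psi> X 1 = \<psi>1 X))))"


proof (intro conjI allI impI, goal_cases)
  case (1 V p C)
  then show ?case
    by (intro B_dB_bounded_below) auto
next
  case (2 V C k3 \<tau> \<epsilon> \<psi>0 \<psi>1)
  have "0 < 1 / \<tau>\<^sup>2 + C X 0" for X
  proof -
    \<comment> \<open>\<open>k3\<close> is an infimum of reals, a lower bound by the
      \<open>bdd_below\<close> hypothesis.\<close>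
    have "k3 \<le> C X 0"
      using 2 by (auto intro: cINF_lower)
    then show ?thesis
      using inverse_square_add_pos_if_less_tau3[of \<tau> k3] 2 by linarith
  qed
  then show ?case
    using 2 by (intro discrete_wave_cauchy_problem[where p = 4 and C = C]) (auto simp: C2_real_def)
qed

end
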